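(* Let $A$ and $B$ be Banach algebras and let $T:B\to A$ be a bounded algebra homomorphism with $\|T\|\le 1$. Then the $T$-Lau product $A\times_T B$ is approximately cyclic amenable if and only if both of the following statements hold: (1) $A$ and $B$ are approximately cyclic amenable; (2) $A^2$ is dense in $A$ or $B^2$ is dense in $B$.
   Context: Banach algebras are over $\mathbb{C}$, not assumed commutative or unital. For a Banach algebra $A$, $A^2$ denotes the linear span of $\{ac : a,c\in A\}$. $T$-Lau product: for Banach algebras $A,B$ and a bounded homomorphism $T:B\to A$ with $\|T\|\le 1$, $A\times_T B$ is the space $A\times B$ with norm $\|(a,b)\|=\|a\|+\|b\|$ and multiplication $(a,b)(a',b')=(aa'+aT(b')+T(b)a',\,bb')$; it is a Banach algebra. Approximate cyclic amenability: for a Banach algebra $A$, the dual $A^*$ is a Banach $A$-bimodule via $(fa)(x)=f(ax)$ and $(af)(x)=f(xa)$ for $a,x\in A$, $f\in A^*$. A derivation $D:A\to A^*$ is a linear map with $D(ac)=D(a)c+aD(c)$ for all $a,c\in A$. It is cyclic if $D(a)(c)+D(c)(a)=0$ for all $a,c\in A$. For $f\in A^*$ let $d_f(a)=af-fa$. $D$ is approximately inner if there is a net $(f_\alpha)$ in $A^*$ with $D=\lim_\alpha d_{f_\alpha}$ in the strong operator topology, i.e. $\|D(a)-(af_\alpha-f_\alpha a)\|\to 0$ for every $a\in A$. $A$ is approximately cyclic amenable if every continuous cyclic derivation $D:A\to A^*$ is approximately inner. *)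

theory Defs
  imports "HOL-Analysis.Analysis"
begin

section \<open>Complex Banach spaces\<close>

text \<open>
  The library's normed spaces are real. The following class adds a complex scalar multiplication
  extending the real one.
\<close>

class complex_normed_vector = real_normed_vector +
  fixes scaleC :: "complex \<Rightarrow> 'a \<Rightarrow> 'a" (infixr "*\<^sub>C" 75)
  assumes scaleC_add_right: "c *\<^sub>C (x + y) = c *\<^sub>C x + c *\<^sub>C y"
    and scaleC_add_left: "(c + d) *\<^sub>C x = c *\<^sub>C x + d *\<^sub>C x"
    and scaleC_scaleC: "c *\<^sub>C d *\<^sub>C x = (c * d) *\<^sub>C x"
    and scaleC_of_real: "complex_of_real r *\<^sub>C x = r *\<^sub>R x"
    and norm_scaleC: "norm (c *\<^sub>C x) = cmod c * norm x"

class complex_banach = complex_normed_vector + complete_space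
begin

subclass banach ..

end

lemma scaleC_one: "1 *\<^sub>C (x :: 'a::complex_normed_vector) = x"
  using scaleC_of_real[of 1 x] by simp

global_interpretation complex_vector: vector_space "scaleC :: complex \<Rightarrow> 'a \<Rightarrow> 'a::complex_normed_vector"
  by unfold_locales (simp_all add: scaleC_add_right scaleC_add_left scaleC_scaleC scaleC_one)

instantiation complex :: complex_banach
begin

definition scaleC_complex :: "complex \<Rightarrow> complex \<Rightarrow> complex" where
  "scaleC_complex c x = c * x"

instance
  by standard (simp_all add: scaleC_complex_def algebra_simps norm_mult scaleR_conv_of_real)

end

lemma bounded_linear_scaleC_right: "bounded_linear (\<lambda>x. c *\<^sub>C (x :: 'a::complex_normed_vector))"
proof (rule bounded_linear_intro[where K = "cmod c"])
  fix r :: real and x y :: 'a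
  show "c *\<^sub>C (x + y) = c *\<^sub>C x + c *\<^sub>C y" by (rule scaleC_add_right)
  show "c *\<^sub>C r *\<^sub>R x = r *\<^sub>R c *\<^sub>C x"
    by (simp add: scaleC_scaleC mult.commute flip: scaleC_of_real)
  show "norm (c *\<^sub>C x) \<le> norm x * cmod c" by (simp add: norm_scaleC)
qed

instantiation blinfun :: (real_normed_vector, complex_normed_vector) complex_normed_vector
begin

definition scaleC_blinfun :: "complex \<Rightarrow> 'a \<Rightarrow>\<^sub>L 'b \<Rightarrow> 'a \<Rightarrow>\<^sub>L 'b" where
  "scaleC_blinfun c f = Blinfun (\<lambda>x. c *\<^sub>C blinfun_apply f x)"

lemma scaleC_blinfun_apply: "blinfun_apply (c *\<^sub>C f) x = c *\<^sub>C blinfun_apply f x"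
  unfolding scaleC_blinfun_def
  by (subst bounded_linear_Blinfun_apply)
    (auto intro: bounded_linear_compose[OF bounded_linear_scaleC_right] blinfun.bounded_linear_right)

lemma norm_scaleC_blinfun_le: "norm (c *\<^sub>C (f :: 'a \<Rightarrow>\<^sub>L 'b)) \<le> cmod c * norm f"
proof (rule norm_blinfun_bound)
  fix x
  have "cmod c * norm (blinfun_apply f x) \<le> cmod c * (norm f * norm x)"
    by (intro mult_left_mono norm_blinfun) simp
  then show "norm (blinfun_apply (c *\<^sub>C f) x) \<le> cmod c * norm f * norm x"
    by (simp add: scaleC_blinfun_apply norm_scaleC mult.assoc)
qed simp

instance
proof
  fix c d :: complex and r :: real and f g :: "'a \<Rightarrow>\<^sub>L 'b"
  show "c *\<^sub>C (f + g) = c *\<^sub>C f + c *\<^sub>C g"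
    by (rule blinfun_eqI) (simp add: scaleC_blinfun_apply blinfun.add_left scaleC_add_right)
  show "(c + d) *\<^sub>C f = c *\<^sub>C f + d *\<^sub>C f"
    by (rule blinfun_eqI) (simp add: scaleC_blinfun_apply blinfun.add_left scaleC_add_left)
  show assoc: "c *\<^sub>C d *\<^sub>C f = (c * d) *\<^sub>C f" for c d and f :: "'a \<Rightarrow>\<^sub>L 'b"
    by (rule blinfun_eqI) (simp add: scaleC_blinfun_apply scaleC_scaleC)
  show of_real: "complex_of_real r *\<^sub>C f = r *\<^sub>R f" for r and f :: "'a \<Rightarrow>\<^sub>L 'b"
    by (rule blinfun_eqI) (simp add: scaleC_blinfun_apply blinfun.scaleR_left scaleC_of_real)
  show "norm (c *\<^sub>C f) = cmod c * norm f"
  proof (cases "c = 0")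
    case True
    then show ?thesis using of_real[of 0 f] by simp
  next
    case False
    have "f = inverse c *\<^sub>C c *\<^sub>C f"
      using False of_real[of 1 f] by (simp add: assoc)
    then have "norm f \<le> cmod (inverse c) * norm (c *\<^sub>C f)"
      using norm_scaleC_blinfun_le[of "inverse c" "c *\<^sub>C f"] by metis
    then have "cmod c * norm f \<le> norm (c *\<^sub>C f)"
      using False by (simp add: norm_divide field_simps)
    with norm_scaleC_blinfun_le[of c f] show ?thesis by simp
  qed
qed

end

text \<open>
  \<open>'a \<Rightarrow>\<^sub>L complex\<close> consists of the bounded real-linear maps; the dual space is its subspace of
  complex-linear ones, with the same (operator) norm.
\<close>

definition dual_space :: "('a::complex_normed_vector \<Rightarrow>\<^sub>L complex) set" where
  "dual_space = {f. Vector_Spaces.linear scaleC scaleC (blinfun_apply f)}"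


section \<open>Banach algebras\<close>

text \<open>
  The multiplication is an explicit parameter rather than the class operation \<open>(*)\<close>, since that
  of the T-Lau product depends on T, which cannot be recorded in a type.
\<close>

locale complex_banach_algebra =
  fixes mul :: "'a::complex_banach \<Rightarrow> 'a \<Rightarrow> 'a"
  assumes mul_assoc: "mul (mul x y) z = mul x (mul y z)"
    and mul_add_left: "mul (x + y) z = mul x z + mul y z"
    and mul_add_right: "mul x (y + z) = mul x y + mul x z"
    and mul_scaleC_left: "mul (c *\<^sub>C x) y = c *\<^sub>C mul x y"
    and mul_scaleC_right: "mul x (c *\<^sub>C y) = c *\<^sub>C mul x y"
    and norm_mul_le: "norm (mul x y) \<le> norm x * norm y"
begin

lemma bounded_bilinear_mul: "bounded_bilinear mul"
proof
  fix r :: real and x y z :: 'a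
  show "mul (x + y) z = mul x z + mul y z" by (rule mul_add_left)
  show "mul x (y + z) = mul x y + mul x z" by (rule mul_add_right)
  show "mul (r *\<^sub>R x) y = r *\<^sub>R mul x y" by (simp add: mul_scaleC_left flip: scaleC_of_real)
  show "mul x (r *\<^sub>R y) = r *\<^sub>R mul x y" by (simp add: mul_scaleC_right flip: scaleC_of_real)
  show "\<exists>K. \<forall>x y. norm (mul x y) \<le> norm x * norm y * K"
    by (rule exI[of _ 1]) (simp add: norm_mul_le)
qed

end

text \<open>The linear span of all products.\<close>

definition algebra_square :: "('a::complex_banach \<Rightarrow> 'a \<Rightarrow> 'a) \<Rightarrow> 'a set" where
  "algebra_square mul = complex_vector.span {mul a c | a c. True}"

definition algebra_homomorphism ::
  "('b::complex_banach \<Rightarrow> 'b \<Rightarrow> 'b) \<Rightarrow> ('a::complex_banach \<Rightarrow> 'a \<Rightarrow> 'a) \<Rightarrow> ('b \<Rightarrow> 'a) \<Rightarrow> bool" where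
  "algebra_homomorphism mulB mulA T \<longleftrightarrow>
     Vector_Spaces.linear scaleC scaleC T \<and> (\<forall>x y. T (mulB x y) = mulA (T x) (T y))"


section \<open>Approximate cyclic amenability\<close>

definition dual_left :: "('a::complex_banach \<Rightarrow> 'a \<Rightarrow> 'a) \<Rightarrow> 'a \<Rightarrow> ('a \<Rightarrow>\<^sub>L complex) \<Rightarrow> ('a \<Rightarrow>\<^sub>L complex)" where
  "dual_left mul a f = Blinfun (\<lambda>x. blinfun_apply f (mul x a))"

definition dual_right :: "('a::complex_banach \<Rightarrow> 'a \<Rightarrow> 'a) \<Rightarrow> ('a \<Rightarrow>\<^sub>L complex) \<Rightarrow> 'a \<Rightarrow> ('a \<Rightarrow>\<^sub>L complex)" where
  "dual_right mul f a = Blinfun (\<lambda>x. blinfun_apply f (mul a x))"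

context complex_banach_algebra
begin

lemma dual_left_apply: "blinfun_apply (dual_left mul a f) x = blinfun_apply f (mul x a)"
  unfolding dual_left_def
  by (subst bounded_linear_Blinfun_apply)
    (auto intro!: bounded_linear_compose[OF blinfun.bounded_linear_right]
      bounded_bilinear.bounded_linear_left[OF bounded_bilinear_mul])

lemma dual_right_apply: "blinfun_apply (dual_right mul f a) x = blinfun_apply f (mul a x)"
  unfolding dual_right_def
  by (subst bounded_linear_Blinfun_apply)
    (auto intro!: bounded_linear_compose[OF blinfun.bounded_linear_right]
      bounded_bilinear.bounded_linear_right[OF bounded_bilinear_mul])

end

definition derivation :: "('a::complex_banach \<Rightarrow> 'a \<Rightarrow> 'a) \<Rightarrow> ('a \<Rightarrow> 'a \<Rightarrow>\<^sub>L complex) \<Rightarrow> bool" where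
  "derivation mul D \<longleftrightarrow>
     (\<forall>a. D a \<in> dual_space) \<and>
     Vector_Spaces.linear scaleC scaleC D \<and>
     (\<forall>a c. D (mul a c) = dual_right mul (D a) c + dual_left mul a (D c))"

definition cyclic :: "('a::complex_banach \<Rightarrow> 'a \<Rightarrow>\<^sub>L complex) \<Rightarrow> bool" where
  "cyclic D \<longleftrightarrow> (\<forall>a c. blinfun_apply (D a) c + blinfun_apply (D c) a = 0)"

definition inner_derivation ::
  "('a::complex_banach \<Rightarrow> 'a \<Rightarrow> 'a) \<Rightarrow> ('a \<Rightarrow>\<^sub>L complex) \<Rightarrow> 'a \<Rightarrow> 'a \<Rightarrow>\<^sub>L complex" where
  "inner_derivation mul f a = dual_left mul a f - dual_right mul f a"

text \<open>
  The net of functionals is given as a proper filter on the dual space (the filter generated by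
  the tails of the net). The two lemmas after the definition establish the agreement with
  nets indexed by directed sets.
\<close>

definition approximately_inner ::
  "('a::complex_banach \<Rightarrow> 'a \<Rightarrow> 'a) \<Rightarrow> ('a \<Rightarrow> 'a \<Rightarrow>\<^sub>L complex) \<Rightarrow> bool" where
  "approximately_inner mul D \<longleftrightarrow>
     (\<exists>F. F \<noteq> bot \<and> (\<forall>\<^sub>F f in F. f \<in> dual_space) \<and>
          (\<forall>a. ((\<lambda>f. inner_derivation mul f a) \<longlongrightarrow> D a) F))"

definition directed :: "'i set \<Rightarrow> ('i \<Rightarrow> 'i \<Rightarrow> bool) \<Rightarrow> bool" where
  "directed I le \<longleftrightarrow> I \<noteq> {} \<and> (\<forall>i\<in>I. le i i) \<and>
     (\<forall>i\<in>I. \<forall>j\<in>I. \<forall>k\<in>I. le i j \<longrightarrow> le j k \<longrightarrow> le i k) \<and>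
     (\<forall>i\<in>I. \<forall>j\<in>I. \<exists>k\<in>I. le i k \<and> le j k)"

lemma approximately_inner_if_net:
  assumes dir: "directed I le"
    and dual: "\<And>i. i \<in> I \<Longrightarrow> f i \<in> dual_space"
    and lim: "\<And>a e. e > 0 \<Longrightarrow> \<exists>i\<in>I. \<forall>j\<in>I. le i j \<longrightarrow> norm (D a - inner_derivation mul (f j) a) < e"
  shows "approximately_inner mul D"
proof -
  define U where "U i = {f j | j. j \<in> I \<and> le i j}" for i
  define F where "F = (INF i\<in>I. principal (U i))"
  have ne: "I \<noteq> {}" and refl: "\<forall>i\<in>I. le i i"
    and trans: "\<forall>i\<in>I. \<forall>j\<in>I. \<forall>k\<in>I. le i j \<longrightarrow> le j k \<longrightarrow> le i k"
    and ub: "\<forall>i\<in>I. \<forall>j\<in>I. \<exists>k\<in>I. le i k \<and> le j k"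
    using dir unfolding directed_def by - (elim conjE, assumption)+
  have ev: "eventually P F \<longleftrightarrow> (\<exists>i\<in>I. \<forall>j\<in>I. le i j \<longrightarrow> P (f j))" for P
  proof -
    have "eventually P F \<longleftrightarrow> (\<exists>i\<in>I. eventually P (principal (U i)))"
      unfolding F_def
    proof (rule eventually_INF_base[OF ne])
      fix i j assume ij: "i \<in> I" "j \<in> I"
      then obtain k where k: "k \<in> I" "le i k" "le j k" using ub by meson
      then have "U k \<subseteq> U i \<inter> U j"
        unfolding U_def using trans[rule_format, OF ij(1) k(1)] trans[rule_format, OF ij(2) k(1)] k(2,3) by auto
      then have "principal (U k) \<le> inf (principal (U i)) (principal (U j))"
        by simp
      with k(1) show "\<exists>k\<in>I. principal (U k) \<le> inf (principal (U i)) (principal (U j))"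
        by (rule bexI[rotated])
    qed
    also have "\<dots> \<longleftrightarrow> (\<exists>i\<in>I. \<forall>j\<in>I. le i j \<longrightarrow> P (f j))"
      unfolding eventually_principal U_def by blast
    finally show ?thesis .
  qed
  have "F \<noteq> bot"
    unfolding trivial_limit_def ev using refl by blast
  moreover have "\<forall>\<^sub>F f in F. f \<in> dual_space"
    unfolding ev using ne dual by blast
  moreover have "((\<lambda>f. inner_derivation mul f a) \<longlongrightarrow> D a) F" for a
    unfolding tendsto_iff ev using lim by (simp add: dist_norm norm_minus_commute[of _ "D a"])
  ultimately show ?thesis unfolding approximately_inner_def by blast
qed

lemma net_if_approximately_inner:
  fixes D :: "'a::complex_banach \<Rightarrow> 'a \<Rightarrow>\<^sub>L complex"
  assumes "approximately_inner mul D"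
  obtains I :: "(('a \<Rightarrow>\<^sub>L complex) \<times> ('a \<Rightarrow>\<^sub>L complex) set) set" and le f
  where "directed I le" and "\<And>i. i \<in> I \<Longrightarrow> f i \<in> dual_space"
    and "\<And>a e. e > 0 \<Longrightarrow> \<exists>i\<in>I. \<forall>j\<in>I. le i j \<longrightarrow> norm (D a - inner_derivation mul (f j) a) < e"
proof -
  obtain F where F: "F \<noteq> bot" "\<forall>\<^sub>F f in F. f \<in> dual_space"
    "\<And>a. ((\<lambda>f. inner_derivation mul f a) \<longlongrightarrow> D a) F"
    using assms unfolding approximately_inner_def by blast
  define I where "I = {(f, S). f \<in> S \<and> S \<subseteq> dual_space \<and> (\<forall>\<^sub>F g in F. g \<in> S)}"
  define le where "le = (\<lambda>(f :: 'a \<Rightarrow>\<^sub>L complex, S :: ('a \<Rightarrow>\<^sub>L complex) set)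
                          (g :: 'a \<Rightarrow>\<^sub>L complex, R :: ('a \<Rightarrow>\<^sub>L complex) set). R \<subseteq> S)"
  have ex: "\<exists>f. (f, S) \<in> I" if "\<forall>\<^sub>F g in F. g \<in> S" "S \<subseteq> dual_space" for S
  proof -
    have "\<exists>f. f \<in> S" using eventually_happens'[OF F(1) that(1)] .
    then show ?thesis using that unfolding I_def by blast
  qed
  show thesis
  proof (rule that[of I le fst])
    show "directed I le"
      unfolding directed_def
    proof (intro conjI ballI impI)
      show "I \<noteq> {}" using ex[OF F(2)] by blast
      show "le i i" for i unfolding le_def by (simp split: prod.split)
      show "le i k" if "le i j" "le j k" for i j k
        using that unfolding le_def by (auto split: prod.splits)
      show "\<exists>k\<in>I. le i k \<and> le j k" if "i \<in> I" "j \<in> I" for i j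
      proof -
        obtain f S g R where ij: "i = (f, S)" "j = (g, R)" by (cases i; cases j)
        have "\<forall>\<^sub>F h in F. h \<in> S \<inter> R" "S \<inter> R \<subseteq> dual_space"
          using that unfolding ij I_def by (auto simp: eventually_conj_iff)
        from ex[OF this] obtain h where "(h, S \<inter> R) \<in> I" ..
        moreover have "le i (h, S \<inter> R)" "le j (h, S \<inter> R)"
          unfolding ij le_def by simp_all
        ultimately show ?thesis by blast
      qed
    qed
  next
    show "fst i \<in> dual_space" if "i \<in> I" for i using that unfolding I_def by auto
  next
    fix a and e :: real assume "e > 0"
    define S where "S = {f \<in> dual_space. norm (D a - inner_derivation mul f a) < e}"
    have "\<forall>\<^sub>F f in F. f \<in> S"
      using eventually_conj[OF F(2) tendstoD[OF F(3)[of a] \<open>e > 0\<close>]]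
      by (simp add: S_def dist_norm norm_minus_commute[of _ "D a"])
    moreover have "S \<subseteq> dual_space" unfolding S_def by blast
    ultimately obtain f where "(f, S) \<in> I" using ex by blast
    moreover have "norm (D a - inner_derivation mul (fst j) a) < e" if "j \<in> I" "le (f, S) j" for j
      using that unfolding I_def le_def S_def by auto
    ultimately show "\<exists>i\<in>I. \<forall>j\<in>I. le i j \<longrightarrow> norm (D a - inner_derivation mul (fst j) a) < e"
      by blast
  qed
qed

definition approx_cyclic_amenable :: "('a::complex_banach \<Rightarrow> 'a \<Rightarrow> 'a) \<Rightarrow> bool" where
  "approx_cyclic_amenable mul \<longleftrightarrow>
     (\<forall>D. continuous_on UNIV D \<and> derivation mul D \<and> cyclic D \<longrightarrow> approximately_inner mul D)"


section \<open>The T-Lau product\<close>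

text \<open>
  The library's norm on \<open>'a \<times> 'b\<close> is the Euclidean one, so the product with the norm
  \<open>\<parallel>a\<parallel> + \<parallel>b\<parallel>\<close> needs a type of its own.
\<close>

datatype ('a, 'b) l1_prod = L1 (l1_fst: 'a) (l1_snd: 'b)

lemma l1_prod_eq_iff: "x = y \<longleftrightarrow> l1_fst x = l1_fst y \<and> l1_snd x = l1_snd y"
  by (cases x; cases y) simp

instantiation l1_prod :: (real_normed_vector, real_normed_vector) real_normed_vector
begin

definition "0 = L1 0 0"
definition "x + y = L1 (l1_fst x + l1_fst y) (l1_snd x + l1_snd y)"
definition "x - y = L1 (l1_fst x - l1_fst y) (l1_snd x - l1_snd y)"
definition "- x = L1 (- l1_fst x) (- l1_snd x)"
definition "r *\<^sub>R x = L1 (r *\<^sub>R l1_fst x) (r *\<^sub>R l1_snd x)"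
definition norm_l1_prod :: "('a, 'b) l1_prod \<Rightarrow> real" where
  "norm_l1_prod x = norm (l1_fst x) + norm (l1_snd x)"
definition dist_l1_prod :: "('a, 'b) l1_prod \<Rightarrow> ('a, 'b) l1_prod \<Rightarrow> real" where
  "dist_l1_prod x y = norm (x - y)"
definition sgn_l1_prod :: "('a, 'b) l1_prod \<Rightarrow> ('a, 'b) l1_prod" where
  "sgn_l1_prod x = inverse (norm x) *\<^sub>R x"
definition uniformity_l1_prod :: "(('a, 'b) l1_prod \<times> ('a, 'b) l1_prod) filter" where
  "uniformity_l1_prod = (INF e\<in>{0<..}. principal {(x, y). dist x y < e})"
definition open_l1_prod :: "('a, 'b) l1_prod set \<Rightarrow> bool" where
  "open_l1_prod S \<longleftrightarrow> (\<forall>x\<in>S. \<forall>\<^sub>F (x', y) in uniformity. x' = x \<longrightarrow> y \<in> S)"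

lemmas l1_prod_defs = zero_l1_prod_def plus_l1_prod_def minus_l1_prod_def uminus_l1_prod_def
  scaleR_l1_prod_def

instance
proof
  fix x y z :: "('a, 'b) l1_prod" and r s :: real
  show "x + y + z = x + (y + z)" "x + y = y + x" "0 + x = x" "- x + x = 0" "x - y = x + - y"
    "r *\<^sub>R (x + y) = r *\<^sub>R x + r *\<^sub>R y" "(r + s) *\<^sub>R x = r *\<^sub>R x + s *\<^sub>R x"
    "r *\<^sub>R s *\<^sub>R x = (r * s) *\<^sub>R x" "1 *\<^sub>R x = x"
    by (simp_all add: l1_prod_defs algebra_simps)
  show "norm x = 0 \<longleftrightarrow> x = 0"
    by (cases x) (simp add: norm_l1_prod_def l1_prod_defs add_nonneg_eq_0_iff)
  show "norm (x + y) \<le> norm x + norm y"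
    using norm_triangle_ineq[of "l1_fst x" "l1_fst y"] norm_triangle_ineq[of "l1_snd x" "l1_snd y"]
    by (simp add: norm_l1_prod_def l1_prod_defs)
  show "norm (r *\<^sub>R x) = \<bar>r\<bar> * norm x"
    by (simp add: norm_l1_prod_def l1_prod_defs distrib_left)
qed (simp_all add: dist_l1_prod_def sgn_l1_prod_def uniformity_l1_prod_def open_l1_prod_def)

end

lemma l1_prod_sel [simp]:
  "l1_fst 0 = 0" "l1_snd 0 = 0"
  "l1_fst (x + y) = l1_fst x + l1_fst y" "l1_snd (x + y) = l1_snd x + l1_snd y"
  "l1_fst (x - y) = l1_fst x - l1_fst y" "l1_snd (x - y) = l1_snd x - l1_snd y"
  "l1_fst (- x) = - l1_fst x" "l1_snd (- x) = - l1_snd x"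
  "l1_fst (r *\<^sub>R x) = r *\<^sub>R l1_fst x" "l1_snd (r *\<^sub>R x) = r *\<^sub>R l1_snd x"
  by (simp_all add: l1_prod_defs)

instance l1_prod :: (banach, banach) complete_space
proof
  fix X :: "nat \<Rightarrow> ('a, 'b) l1_prod" assume X: "Cauchy X"
  have "dist (l1_fst x) (l1_fst y) \<le> dist x y" "dist (l1_snd x) (l1_snd y) \<le> dist x y"
    for x y :: "('a, 'b) l1_prod"
    by (simp_all add: dist_norm norm_l1_prod_def)
  with X have "Cauchy (\<lambda>n. l1_fst (X n))" "Cauchy (\<lambda>n. l1_snd (X n))"
    unfolding Cauchy_def by (meson le_less_trans)+
  then obtain a b where ab: "(\<lambda>n. l1_fst (X n)) \<longlonglongrightarrow> a" "(\<lambda>n. l1_snd (X n)) \<longlonglongrightarrow> b"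
    by (meson Cauchy_convergent convergent_def)
  have "(\<lambda>n. norm (l1_fst (X n) - a) + norm (l1_snd (X n) - b)) \<longlonglongrightarrow> 0 + 0"
    using ab by (intro tendsto_add tendsto_norm_zero) (simp_all add: LIM_zero)
  then have "X \<longlonglongrightarrow> L1 a b"
    by (subst tendsto_dist_iff) (simp add: dist_norm norm_l1_prod_def)
  then show "convergent X" unfolding convergent_def by blast
qed

instantiation l1_prod :: (complex_banach, complex_banach) complex_banach
begin

definition scaleC_l1_prod :: "complex \<Rightarrow> ('a, 'b) l1_prod \<Rightarrow> ('a, 'b) l1_prod" where
  "scaleC_l1_prod c x = L1 (c *\<^sub>C l1_fst x) (c *\<^sub>C l1_snd x)"

instance
  by standard
    (simp_all add: scaleC_l1_prod_def l1_prod_eq_iff scaleC_add_right scaleC_add_left scaleC_scaleC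
      scaleC_of_real norm_scaleC norm_l1_prod_def distrib_left)

end

definition lau_mul ::
  "('a::complex_banach \<Rightarrow> 'a \<Rightarrow> 'a) \<Rightarrow> ('b::complex_banach \<Rightarrow> 'b \<Rightarrow> 'b) \<Rightarrow> ('b \<Rightarrow> 'a) \<Rightarrow>
   ('a, 'b) l1_prod \<Rightarrow> ('a, 'b) l1_prod \<Rightarrow> ('a, 'b) l1_prod" where
  "lau_mul mulA mulB T x y =
     L1 (mulA (l1_fst x) (l1_fst y) + mulA (l1_fst x) (T (l1_snd y)) + mulA (T (l1_snd x)) (l1_fst y))
        (mulB (l1_snd x) (l1_snd y))"

lemma complex_banach_algebra_lau_mul:
  assumes A: "complex_banach_algebra mulA" and B: "complex_banach_algebra mulB"
    and hom: "algebra_homomorphism mulB mulA T" and bdd: "bounded_linear T" and le: "onorm T \<le> 1"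
  shows "complex_banach_algebra (lau_mul mulA mulB T)"
proof -
  interpret A: complex_banach_algebra mulA by fact
  interpret B: complex_banach_algebra mulB by fact
  have Tmul: "T (mulB x y) = mulA (T x) (T y)" for x y
    using hom unfolding algebra_homomorphism_def by blast
  interpret T: Vector_Spaces.linear scaleC scaleC T
    using hom unfolding algebra_homomorphism_def by blast
  have nT: "norm (T x) \<le> norm x" for x
    using onorm[OF bdd, of x] mult_right_mono[OF le norm_ge_zero[of x]] by simp
  show ?thesis
  proof
    fix x y z :: "('a, 'b) l1_prod" and c :: complex
    show "lau_mul mulA mulB T (lau_mul mulA mulB T x y) z = lau_mul mulA mulB T x (lau_mul mulA mulB T y z)"
      by (simp add: lau_mul_def Tmul A.mul_add_left A.mul_add_right A.mul_assoc B.mul_assoc)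
    show "lau_mul mulA mulB T (x + y) z = lau_mul mulA mulB T x z + lau_mul mulA mulB T y z"
      by (simp add: lau_mul_def plus_l1_prod_def T.add A.mul_add_left B.mul_add_left)
    show "lau_mul mulA mulB T x (y + z) = lau_mul mulA mulB T x y + lau_mul mulA mulB T x z"
      by (simp add: lau_mul_def plus_l1_prod_def T.add A.mul_add_right B.mul_add_right)
    show "lau_mul mulA mulB T (c *\<^sub>C x) y = c *\<^sub>C lau_mul mulA mulB T x y"
      by (simp add: lau_mul_def scaleC_l1_prod_def T.scale A.mul_scaleC_left B.mul_scaleC_left
          scaleC_add_right)
    show "lau_mul mulA mulB T x (c *\<^sub>C y) = c *\<^sub>C lau_mul mulA mulB T x y"
      by (simp add: lau_mul_def scaleC_l1_prod_def T.scale A.mul_scaleC_right B.mul_scaleC_right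
          scaleC_add_right)
    obtain a b a' b' where xy: "x = L1 a b" "y = L1 a' b'" by (cases x; cases y)
    have "norm (mulA a (T b')) \<le> norm a * norm b'"
      by (rule order_trans[OF A.norm_mul_le]) (intro mult_left_mono nT norm_ge_zero)
    moreover have "norm (mulA (T b) a') \<le> norm b * norm a'"
      by (rule order_trans[OF A.norm_mul_le]) (intro mult_right_mono nT norm_ge_zero)
    moreover have "norm (mulA a a' + mulA a (T b') + mulA (T b) a')
        \<le> norm (mulA a a') + norm (mulA a (T b')) + norm (mulA (T b) a')"
      by (meson add_right_mono norm_triangle_ineq order_trans)
    ultimately show "norm (lau_mul mulA mulB T x y) \<le> norm x * norm y"
      using A.norm_mul_le[of a a'] B.norm_mul_le[of b b']
      by (simp add: xy lau_mul_def norm_l1_prod_def algebra_simps)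
  qed
qed

end

theory Submission
  imports Defs
begin

text \<open>
  The map \<open>(a, b) \<mapsto> (a + T b, b)\<close> identifies the T-Lau product with the direct sum of the two
  algebras, so \<open>T\<close> plays no role. Each summand is a retract of the direct sum and inherits approximate
  cyclic amenability. A cyclic derivation on the direct sum is the sum of its restrictions to the
  summands and of a cross term, which vanishes on products from either summand and, by cyclicity,
  vanishes altogether as soon as one of the squares is dense. If neither is, functionals
  annihilating the squares yield a derivation consisting of a cross term only, which is not
  approximately inner.
\<close>

section \<open>Functionals separating points from closed subspaces\<close>

definition sublinear :: "('v::real_vector \<Rightarrow> real) \<Rightarrow> bool" where
  "sublinear p \<longleftrightarrow> (\<forall>x y. p (x + y) \<le> p x + p y) \<and> (\<forall>r x. 0 \<le> r \<longrightarrow> p (r *\<^sub>R x) = r * p x)"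

lemma sublinear_add: "sublinear p \<Longrightarrow> p (x + y) \<le> p x + p y"
  and sublinear_scaleR: "sublinear p \<Longrightarrow> 0 \<le> r \<Longrightarrow> p (r *\<^sub>R x) = r * p x"
  by (simp_all add: sublinear_def)

lemma sublinear_zero: "sublinear p \<Longrightarrow> p 0 = 0"
  using sublinear_scaleR[of p 0 0] by simp

lemma sublinear_minus_ge: "sublinear p \<Longrightarrow> - p (- x) \<le> p x"
  using sublinear_add[of p x "- x"] sublinear_zero[of p] by simp

text \<open>The reverse inequality for positive \<open>r\<close> comes from the assumed one, applied
  with \<open>inverse r\<close> at the point \<open>r *\<^sub>R x\<close>.\<close>

lemma sublinearI:
  assumes add: "\<And>x y. p (x + y) \<le> p x + p y"
    and scale: "\<And>r x. 0 < r \<Longrightarrow> p (r *\<^sub>R x) \<le> r * p x"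
    and zero: "p 0 = 0"
  shows "sublinear p"
  unfolding sublinear_def
proof (intro conjI allI impI)
  show "p (r *\<^sub>R x) = r * p x" if "0 \<le> r" for r x
  proof (cases "r = 0")
    case False
    with that have r: "0 < r" by simp
    have "p x \<le> inverse r * p (r *\<^sub>R x)"
      using scale[of "inverse r" "r *\<^sub>R x"] r by simp
    with r have "r * p x \<le> p (r *\<^sub>R x)" by (simp add: field_simps)
    with scale[OF r, of x] show ?thesis by simp
  qed (simp add: zero)
qed (rule add)

text \<open>All members lie above \<open>- p (- x)\<close>, so the infima are finite. Subadditivity
  needs the chain condition: of two members picked for x and for y, the smaller one can be used at
  both points. This supplies the bounds of chains for Zorn's lemma.\<close>

lemma sublinear_INF_chain:
  assumes ne: "C \<noteq> {}" and sub: "\<And>q. q \<in> C \<Longrightarrow> sublinear q"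
    and le: "\<And>q x. q \<in> C \<Longrightarrow> q x \<le> p x"
    and chain: "\<And>q r. q \<in> C \<Longrightarrow> r \<in> C \<Longrightarrow> (\<forall>x. q x \<le> r x) \<or> (\<forall>x. r x \<le> q x)"
  shows "sublinear (\<lambda>x. INF q\<in>C. q x)" and "q \<in> C \<Longrightarrow> (INF q\<in>C. q x) \<le> q x"
proof -
  have bdd: "bdd_below ((\<lambda>q. q x) ` C)" for x
  proof (rule bdd_belowI2)
    show "- p (- x) \<le> q x" if "q \<in> C" for q
      using sublinear_minus_ge[OF sub[OF that], of x] le[OF that, of "- x"] by linarith
  qed
  have lower: "(INF q\<in>C. q x) \<le> q x" if "q \<in> C" for q x
    by (rule cINF_lower[OF bdd that])
  then show "q \<in> C \<Longrightarrow> (INF q\<in>C. q x) \<le> q x" .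
  show "sublinear (\<lambda>x. INF q\<in>C. q x)"
  proof (rule sublinearI)
    fix x y
    have *: "(INF q\<in>C. q (x + y)) \<le> q x + r y" if q: "q \<in> C" and r: "r \<in> C" for q r
    proof -
      obtain s where s: "s \<in> C" "s x \<le> q x" "s y \<le> r y"
        using chain[OF q r] q r by auto
      then show ?thesis
        using lower[OF s(1), of "x + y"] sublinear_add[OF sub[OF s(1)], of x y] by linarith
    qed
    \<comment> \<open>Taking the infimum over \<open>q\<close> with \<open>r\<close> fixed, and only
      then over \<open>r\<close>, separates the two infima.\<close>
    have "(INF q\<in>C. q (x + y)) - r y \<le> (INF q\<in>C. q x)" if "r \<in> C" for r
      by (rule cINF_greatest[OF ne]) (use * that in \<open>simp add: algebra_simps\<close>)
    then have "(INF q\<in>C. q (x + y)) - (INF q\<in>C. q x) \<le> (INF r\<in>C. r y)"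
      by (intro cINF_greatest[OF ne]) (simp add: algebra_simps)
    then show "(INF q\<in>C. q (x + y)) \<le> (INF q\<in>C. q x) + (INF q\<in>C. q y)" by simp
  next
    fix r :: real and x assume r: "0 < r"
    have "(INF q\<in>C. q (r *\<^sub>R x)) / r \<le> (INF q\<in>C. q x)"
    proof (rule cINF_greatest[OF ne])
      fix q assume "q \<in> C"
      then show "(INF q\<in>C. q (r *\<^sub>R x)) / r \<le> q x"
        using lower[of q "r *\<^sub>R x"] sublinear_scaleR[OF sub, of q r x] r by (simp add: field_simps)
    qed
    with r show "(INF q\<in>C. q (r *\<^sub>R x)) \<le> r * (INF q\<in>C. q x)" by (simp add: field_simps)
  next
    show "(INF q\<in>C. q 0) = 0" using ne sub by (simp add: sublinear_zero)
  qed
qed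

text \<open>Lowers \<open>p\<close> so that it becomes linear along the ray through \<open>y\<close>.\<close>

definition flatten :: "('v::real_vector \<Rightarrow> real) \<Rightarrow> 'v \<Rightarrow> 'v \<Rightarrow> real" where
  "flatten p y x = (INF t\<in>{0..}. p (x + t *\<^sub>R y) - t * p y)"

text \<open>Writing t y as (x + t y) + (- x) bounds the values below by \<open>- p (- x)\<close>, so
  the infimum defining \<open>flatten\<close> is a genuine one.\<close>

lemma flatten_le:
  assumes "sublinear p" "0 \<le> t"
  shows "flatten p y x \<le> p (x + t *\<^sub>R y) - t * p y"
  unfolding flatten_def
proof (rule cINF_lower)
  show "bdd_below ((\<lambda>t. p (x + t *\<^sub>R y) - t * p y) ` {0..})"
  proof (rule bdd_belowI2)
    fix t :: real assume "t \<in> {0..}"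
    then have "t * p y \<le> p (x + t *\<^sub>R y) + p (- x)"
      using sublinear_add[OF assms(1), of "x + t *\<^sub>R y" "- x"] sublinear_scaleR[OF assms(1), of t y]
      by simp
    then show "- p (- x) \<le> p (x + t *\<^sub>R y) - t * p y" by linarith
  qed
qed (use assms in simp)

lemma flatten_greatest:
  "(\<And>t. 0 \<le> t \<Longrightarrow> c \<le> p (x + t *\<^sub>R y) - t * p y) \<Longrightarrow> c \<le> flatten p y x"
  unfolding flatten_def by (rule cINF_greatest) auto

text \<open>Ray parameters follow the points: s for u and t for v give s + t for u + v, and t for x
  gives r t for r x.\<close>

lemma sublinear_flatten:
  assumes p: "sublinear p"
  shows "sublinear (flatten p y)"
proof (rule sublinearI)
  fix u v
  have *: "flatten p y (u + v) \<le> (p (u + s *\<^sub>R y) - s * p y) + (p (v + t *\<^sub>R y) - t * p y)"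
    if "0 \<le> s" "0 \<le> t" for s t
    using flatten_le[OF p, of "s + t" y "u + v"] that
      sublinear_add[OF p, of "u + s *\<^sub>R y" "v + t *\<^sub>R y"]
    by (simp add: algebra_simps)
  have "flatten p y (u + v) - (p (v + t *\<^sub>R y) - t * p y) \<le> flatten p y u" if "0 \<le> t" for t
    by (rule flatten_greatest) (use *[OF _ that] in \<open>simp add: algebra_simps\<close>)
  then have "flatten p y (u + v) - flatten p y u \<le> flatten p y v"
    by (intro flatten_greatest) (simp add: algebra_simps)
  then show "flatten p y (u + v) \<le> flatten p y u + flatten p y v" by simp
next
  fix r :: real and x assume r: "0 < r"
  have "flatten p y (r *\<^sub>R x) / r \<le> flatten p y x"
  proof (rule flatten_greatest)
    fix t :: real assume t: "0 \<le> t"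
    have "flatten p y (r *\<^sub>R x) \<le> p (r *\<^sub>R (x + t *\<^sub>R y)) - r * t * p y"
      using flatten_le[OF p, of "r * t" y "r *\<^sub>R x"] r t by (simp add: algebra_simps)
    also have "\<dots> = r * (p (x + t *\<^sub>R y) - t * p y)"
      using r by (simp only: sublinear_scaleR[OF p less_imp_le]) (simp add: right_diff_distrib)
    finally show "flatten p y (r *\<^sub>R x) / r \<le> p (x + t *\<^sub>R y) - t * p y"
      using r by (simp add: field_simps)
  qed
  with r show "flatten p y (r *\<^sub>R x) \<le> r * flatten p y x" by (simp add: field_simps)
next
  show "flatten p y 0 = 0"
  proof (rule antisym)
    show "flatten p y 0 \<le> 0" using flatten_le[OF p, of 0 y 0] sublinear_zero[OF p] by simp
    show "0 \<le> flatten p y 0"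
      by (rule flatten_greatest) (simp add: sublinear_scaleR[OF p])
  qed
qed

text \<open>The Hahn--Banach theorem: a pointwise minimal sublinear functional equals each of its
  flattenings, which makes it additive.\<close>

lemma sublinear_dominates_linear:
  fixes p :: "'v::real_vector \<Rightarrow> real"
  assumes p: "sublinear p"
  obtains f where "linear f" "\<And>x. f x \<le> p x"
proof -
  define S where "S = {q. sublinear q \<and> (\<forall>x. q x \<le> p x)}"
  \<comment> \<open>The order is reversed because Zorn's lemma yields maximal elements, while a
    pointwise minimal functional is wanted.\<close>
  define R where "R = (\<lambda>q r :: 'v \<Rightarrow> real. \<forall>x. r x \<le> q x)"
  have "partial_order_on S (relation_of R S)"
    by (rule partial_order_on_relation_ofI) (auto simp: R_def fun_eq_iff intro: order_trans antisym)
  moreover have "\<exists>u\<in>S. \<forall>q\<in>C. R q u" if C: "C \<in> Chains (relation_of R S)" for C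
  proof (cases "C = {}")
    case True
    then show ?thesis using p unfolding S_def by auto
  next
    case False
    have CS: "q \<in> S" if "q \<in> C" for q
      using C that unfolding Chains_def relation_of_def by blast
    have chain: "(\<forall>x. q x \<le> r x) \<or> (\<forall>x. r x \<le> q x)" if "q \<in> C" "r \<in> C" for q r
      using C that unfolding Chains_def relation_of_def R_def by blast
    let ?u = "\<lambda>x. INF q\<in>C. q x"
    have u: "sublinear ?u" "\<And>q x. q \<in> C \<Longrightarrow> ?u x \<le> q x"
      using sublinear_INF_chain[OF False, of p] CS chain unfolding S_def by blast+
    from False obtain q where "q \<in> C" by blast
    with u(2) CS have "?u x \<le> p x" for x unfolding S_def by (force intro: order_trans)
    with u show ?thesis by (intro bexI[of _ ?u]) (simp_all add: S_def R_def)
  qed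
  ultimately obtain f where f: "f \<in> S" and min: "\<And>q. q \<in> S \<Longrightarrow> R f q \<Longrightarrow> q = f"
    using predicate_Zorn[of S R] by blast
  have sub: "sublinear f" and le: "f x \<le> p x" for x using f unfolding S_def by auto
  \<comment> \<open>Taking t = 0 puts the flattening below \<open>f\<close>, so minimality leaves
    only equality.\<close>
  have flat: "flatten f y = f" for y
  proof (rule min)
    have "flatten f y x \<le> f x" for x using flatten_le[OF sub, of 0 y x] by simp
    then show "R f (flatten f y)" "flatten f y \<in> S"
      using le sublinear_flatten[OF sub] unfolding R_def S_def by (auto intro: order_trans)
  qed
  \<comment> \<open>With t = 1 the flattening bounds \<open>f x\<close> by
    \<open>f (x + y) - f y\<close>, the half of additivity that sublinearity does not give.\<close>
  have add: "f (x + y) = f x + f y" for x y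
    using flatten_le[OF sub, of 1 y x] sublinear_add[OF sub, of x y] by (simp add: flat)
  have minus: "f (- x) = - f x" for x
    using add[of x "- x"] sublinear_zero[OF sub] by simp
  have "f (r *\<^sub>R x) = r * f x" for r x
  proof (cases "0 \<le> r")
    case False
    then have "f ((- r) *\<^sub>R x) = - r * f x" by (intro sublinear_scaleR[OF sub]) simp
    then show ?thesis by (simp add: minus)
  qed (rule sublinear_scaleR[OF sub])
  then have "linear f" by (intro linearI) (simp_all add: add)
  with le show thesis by (rule that[rotated])
qed

text \<open>This is the quotient seminorm modulo \<open>M\<close>. The distance need not be
  attained, so nearly closest points are added or scaled inside \<open>M\<close>, at the cost of an
  arbitrarily small error.\<close>

lemma sublinear_infdist:
  fixes M :: "'v::real_normed_vector set"
  assumes M: "subspace M"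
  shows "sublinear (\<lambda>x. infdist x M)"
proof (rule sublinearI)
  have ne: "M \<noteq> {}" using subspace_0[OF M] by blast
  have approx: "\<exists>m\<in>M. dist x m < infdist x M + e" if "0 < e" for x e
    using cInf_lessD[of "dist x ` M" "infdist x M + e"] ne that
    by (auto simp: infdist_def)
  fix x y
  show "infdist (x + y) M \<le> infdist x M + infdist y M"
  proof (rule field_le_epsilon)
    fix e :: real assume "0 < e"
    then obtain m n where mn: "m \<in> M" "dist x m < infdist x M + e / 2"
      "n \<in> M" "dist y n < infdist y M + e / 2"
      using approx[of "e / 2"] by (metis half_gt_zero)
    have "infdist (x + y) M \<le> dist (x + y) (m + n)"
      by (rule infdist_le[OF subspace_add[OF M mn(1,3)]])
    also have "\<dots> \<le> dist x m + dist y n" by (rule dist_triangle_add)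
    finally show "infdist (x + y) M \<le> infdist x M + infdist y M + e" using mn by linarith
  qed
  show "infdist (r *\<^sub>R x) M \<le> r * infdist x M" if "0 < r" for r
  proof (rule field_le_epsilon)
    fix e :: real assume "0 < e"
    with that obtain m where m: "m \<in> M" "dist x m < infdist x M + e / r"
      using approx[of "e / r"] by auto
    have "infdist (r *\<^sub>R x) M \<le> dist (r *\<^sub>R x) (r *\<^sub>R m)"
      by (rule infdist_le[OF subspace_scale[OF M m(1)]])
    also have "\<dots> = r * dist x m" using that by (simp add: dist_norm flip: scaleR_diff_right)
    also have "\<dots> \<le> r * (infdist x M + e / r)" using m that by (intro mult_left_mono) auto
    finally show "infdist (r *\<^sub>R x) M \<le> r * infdist x M + e" using that by (simp add: distrib_left)
  qed
  show "infdist 0 M = 0" using subspace_0[OF M] by simp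
qed

section \<open>Annihilators in the complex dual space\<close>

lemma blinfun_eq_iff: "f = g \<longleftrightarrow> (\<forall>x. blinfun_apply f x = blinfun_apply g x)"
  by (auto intro: blinfun_eqI)

lemma complex_linear_iff:
  fixes f :: "'a::complex_normed_vector \<Rightarrow> 'b::complex_normed_vector"
  shows "Vector_Spaces.linear scaleC scaleC f \<longleftrightarrow>
    (\<forall>x y. f (x + y) = f x + f y) \<and> (\<forall>c x. f (c *\<^sub>C x) = c *\<^sub>C f x)"
  by (simp add: Vector_Spaces.linear_iff complex_vector.vector_space_axioms)

lemma dual_space_iff: "f \<in> dual_space \<longleftrightarrow> (\<forall>c x. blinfun_apply f (c *\<^sub>C x) = c * blinfun_apply f x)"
  by (simp add: dual_space_def complex_linear_iff blinfun.add_right scaleC_complex_def)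

text \<open>Hahn-Banach is applied to the distance from \<open>M\<close>, flattened along a point
  outside the closure. Domination by the distance gives boundedness and vanishing on
  \<open>M\<close>, and the flattening keeps the functional nonzero at that point. The real
  functional is then complexified.\<close>

lemma exists_dual_annihilator:
  fixes M :: "'a::complex_normed_vector set"
  assumes M: "complex_vector.subspace M" and nd: "closure M \<noteq> UNIV"
  obtains f x where "f \<in> dual_space" "blinfun_apply f x \<noteq> 0" "\<And>m. m \<in> M \<Longrightarrow> blinfun_apply f m = 0"
proof -
  have sub: "subspace M"
    unfolding subspace_def using M[unfolded complex_vector.subspace_def]
    by (simp flip: scaleC_of_real)
  have ne: "M \<noteq> {}" using subspace_0[OF sub] by blast
  from nd obtain x0 where "x0 \<notin> closure M" by blast
  then have pos: "0 < infdist x0 M"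
    using in_closure_iff_infdist_zero[OF ne] infdist_nonneg[of x0 M] by (metis order_le_less)
  let ?p = "\<lambda>x. infdist x M"
  have p: "sublinear ?p" by (rule sublinear_infdist[OF sub])
  obtain g where g: "linear g" and g_le: "\<And>x. g x \<le> flatten ?p x0 x"
    using sublinear_dominates_linear[OF sublinear_flatten[OF p]] by blast
  interpret g: linear g by fact
  have le: "g x \<le> ?p x" for x
    using g_le[of x] flatten_le[OF p, of 0 x0 x] by simp
  \<comment> \<open>At \<open>- x0\<close> the choice t = 1 bounds the flattening by
    \<open>infdist 0 M - infdist x0 M\<close>, which is negative.\<close>
  have "g (- x0) \<le> - ?p x0"
    using g_le[of "- x0"] flatten_le[OF p, of 1 x0 "- x0"] subspace_0[OF sub] by simp
  with pos have g0: "g x0 \<noteq> 0" by (simp add: g.neg)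
  have p_norm: "?p x \<le> norm x" for x
    using infdist_le[OF subspace_0[OF sub], of x] by simp
  have g_norm: "\<bar>g x\<bar> \<le> norm x" for x
    using le[of x] le[of "- x"] p_norm[of x] p_norm[of "- x"] by (simp add: g.neg)
  \<comment> \<open>The distance is zero at both \<open>m\<close> and \<open>- m\<close>, which
    squeezes \<open>g m\<close> from both sides.\<close>
  have gM: "g m = 0" if "m \<in> M" for m
    using le[of m] le[of "- m"] that subspace_neg[OF sub that] by (simp add: g.neg)
  \<comment> \<open>The standard complexification with real part \<open>g\<close>; the imaginary
    part is forced by h(i x) = i h(x).\<close>
  define h where "h x = Complex (g x) (- g (\<i> *\<^sub>C x))" for x
  have h_add: "h (x + y) = h x + h y" for x y
    by (simp add: h_def g.add scaleC_add_right complex_eq_iff)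
  have split: "c *\<^sub>C x = Re c *\<^sub>R x + Im c *\<^sub>R (\<i> *\<^sub>C x)" for c and x :: 'a
  proof -
    have "c *\<^sub>C x = (complex_of_real (Re c) + complex_of_real (Im c) * \<i>) *\<^sub>C x"
      by (simp add: complex_eq_iff)
    then show ?thesis by (simp only: scaleC_add_left scaleC_of_real flip: scaleC_scaleC)
  qed
  have ii: "\<i> *\<^sub>C \<i> *\<^sub>C x = - x" for x :: 'a
    using scaleC_of_real[of "-1" x] by (simp add: scaleC_scaleC)
  have i_scaleR: "\<i> *\<^sub>C (r *\<^sub>R x) = r *\<^sub>R (\<i> *\<^sub>C x)" for r and x :: 'a
    by (simp add: scaleC_scaleC mult.commute flip: scaleC_of_real)
  have h_scaleC: "h (c *\<^sub>C x) = c * h x" for c x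
    unfolding split[of c x]
    by (simp add: h_def g.add g.diff g.scale g.neg scaleC_add_right i_scaleR ii complex_eq_iff)
  \<comment> \<open>The constant 2 comes from adding the bounds on the real and the imaginary
    part.\<close>
  have h_bl: "bounded_linear h"
  proof (rule bounded_linear_intro[where K = 2])
    show "h (r *\<^sub>R x) = r *\<^sub>R h x" for r x
      using h_scaleC[of "complex_of_real r" x] by (simp add: scaleC_of_real scaleR_conv_of_real)
    show "norm (h x) \<le> norm x * 2" for x
      using cmod_le[of "h x"] g_norm[of x] g_norm[of "\<i> *\<^sub>C x"] by (simp add: h_def norm_scaleC)
  qed (rule h_add)
  have *: "blinfun_apply (Blinfun h) = h" by (rule bounded_linear_Blinfun_apply[OF h_bl])
  show thesis
  proof (rule that[of "Blinfun h" x0])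
    show "Blinfun h \<in> dual_space" by (simp add: dual_space_iff * h_scaleC)
    show "blinfun_apply (Blinfun h) x0 \<noteq> 0" using g0 by (simp add: * h_def complex_eq_iff)
    show "blinfun_apply (Blinfun h) m = 0" if "m \<in> M" for m
      using gM[OF that] gM[of "\<i> *\<^sub>C m"] complex_vector.subspace_scale[OF M that]
      by (simp add: * h_def complex_eq_iff)
  qed
qed


section \<open>Direct sums of Banach algebras\<close>

lemma (in complex_banach_algebra) derivation_apply:
  "derivation mul D \<longleftrightarrow>
     (\<forall>a c x. blinfun_apply (D a) (c *\<^sub>C x) = c * blinfun_apply (D a) x) \<and>
     (\<forall>a b x. blinfun_apply (D (a + b)) x = blinfun_apply (D a) x + blinfun_apply (D b) x) \<and>
     (\<forall>c a x. blinfun_apply (D (c *\<^sub>C a)) x = c * blinfun_apply (D a) x) \<and>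
     (\<forall>a b x. blinfun_apply (D (mul a b)) x = blinfun_apply (D a) (mul b x) + blinfun_apply (D b) (mul x a))"
  unfolding derivation_def complex_linear_iff blinfun_eq_iff dual_space_iff blinfun.add_left
    dual_left_apply dual_right_apply scaleC_blinfun_apply scaleC_complex_def
  by blast

lemma (in complex_banach_algebra) inner_derivation_apply:
  "blinfun_apply (inner_derivation mul f a) x = blinfun_apply f (mul x a) - blinfun_apply f (mul a x)"
  by (simp add: inner_derivation_def blinfun.diff_left dual_left_apply dual_right_apply)

text \<open>Continuity is carried by the type of \<open>h\<close>, so composing a bounded functional
  with \<open>h\<close> stays inside the type of functionals.\<close>

definition banach_hom ::
  "('a::complex_banach \<Rightarrow> 'a \<Rightarrow> 'a) \<Rightarrow> ('b::complex_banach \<Rightarrow> 'b \<Rightarrow> 'b) \<Rightarrow> ('a \<Rightarrow>\<^sub>L 'b) \<Rightarrow> bool" where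
  "banach_hom mulA mulB h \<longleftrightarrow> algebra_homomorphism mulA mulB (blinfun_apply h)"

lemma banach_hom_iff:
  "banach_hom mulA mulB h \<longleftrightarrow> (\<forall>c x. blinfun_apply h (c *\<^sub>C x) = c *\<^sub>C blinfun_apply h x) \<and>
     (\<forall>x y. blinfun_apply h (mulA x y) = mulB (blinfun_apply h x) (blinfun_apply h y))"
  by (auto simp: banach_hom_def algebra_homomorphism_def complex_linear_iff blinfun.add_right)

text \<open>This is \<open>D\<close> between \<open>h\<close> and its adjoint.\<close>

definition pullback :: "('a::complex_banach \<Rightarrow>\<^sub>L 'b::complex_banach) \<Rightarrow> ('b \<Rightarrow> 'b \<Rightarrow>\<^sub>L complex) \<Rightarrow> 'a \<Rightarrow> 'a \<Rightarrow>\<^sub>L complex" where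
  "pullback h D a = D (blinfun_apply h a) o\<^sub>L h"

lemma pullback_apply [simp]:
  "blinfun_apply (pullback h D a) x = blinfun_apply (D (blinfun_apply h a)) (blinfun_apply h x)"
  by (simp add: pullback_def)

lemma dual_space_compose:
  "banach_hom mulA mulB h \<Longrightarrow> f \<in> dual_space \<Longrightarrow> f o\<^sub>L h \<in> dual_space"
  by (simp add: dual_space_iff banach_hom_iff)

text \<open>Multiplicativity of \<open>h\<close> carries the product rule over; cyclicity is an
  identity between values, preserved by substituting images under \<open>h\<close>.\<close>

lemma pullback_cyclic_derivation:
  assumes A: "complex_banach_algebra mulA" and B: "complex_banach_algebra mulB"
    and h: "banach_hom mulA mulB h"
    and D: "continuous_on UNIV D" "derivation mulB D" "cyclic D"
  shows "continuous_on UNIV (pullback h D)" "derivation mulA (pullback h D)" "cyclic (pullback h D)"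
proof -
  show "continuous_on UNIV (pullback h D)"
    unfolding pullback_def
    by (intro bounded_bilinear.continuous_on[OF bounded_bilinear_blinfun_compose]
        continuous_on_compose2[OF D(1)] continuous_intros) auto
  show "derivation mulA (pullback h D)"
    using D(2) h
    unfolding complex_banach_algebra.derivation_apply[OF A] complex_banach_algebra.derivation_apply[OF B]
    by (simp add: banach_hom_iff blinfun.add_right)
  show "cyclic (pullback h D)" using D(3) by (simp add: cyclic_def)
qed

text \<open>A derivation on the retract is pulled back along \<open>\<pi>\<close> and approximated
  there by inner ones. Restricting along \<open>\<iota>\<close> sends inner derivations to inner
  ones and, since \<open>\<pi>\<close> undoes \<open>\<iota>\<close>, recovers the original
  derivation.\<close>

lemma approx_cyclic_amenable_retract:
  assumes P: "complex_banach_algebra mulP" and A: "complex_banach_algebra mulA"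
    and \<pi>: "banach_hom mulP mulA \<pi>" and \<iota>: "banach_hom mulA mulP \<iota>"
    and retract: "\<And>a. blinfun_apply \<pi> (blinfun_apply \<iota> a) = a"
    and aca: "approx_cyclic_amenable mulP"
  shows "approx_cyclic_amenable mulA"
  unfolding approx_cyclic_amenable_def
proof (intro allI impI)
  interpret P: complex_banach_algebra mulP by fact
  interpret A: complex_banach_algebra mulA by fact
  fix D assume "continuous_on UNIV D \<and> derivation mulA D \<and> cyclic D"
  then have "approximately_inner mulP (pullback \<pi> D)"
    using aca pullback_cyclic_derivation[OF P A \<pi>, of D] unfolding approx_cyclic_amenable_def by blast
  then obtain F where F: "F \<noteq> bot" "\<forall>\<^sub>F f in F. f \<in> dual_space"
    "\<And>x. ((\<lambda>f. inner_derivation mulP f x) \<longlongrightarrow> pullback \<pi> D x) F"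
    unfolding approximately_inner_def by blast
  have inner: "inner_derivation mulP f (blinfun_apply \<iota> a) o\<^sub>L \<iota> = inner_derivation mulA (f o\<^sub>L \<iota>) a" for f a
    using \<iota> by (intro blinfun_eqI)
      (simp add: P.inner_derivation_apply A.inner_derivation_apply banach_hom_iff)
  have D: "pullback \<pi> D (blinfun_apply \<iota> a) o\<^sub>L \<iota> = D a" for a
    by (intro blinfun_eqI) (simp add: retract)
  have "((\<lambda>f. inner_derivation mulA (f o\<^sub>L \<iota>) a) \<longlongrightarrow> D a) F" for a
    using bounded_bilinear.tendsto[OF bounded_bilinear_blinfun_compose F(3)[of "blinfun_apply \<iota> a"]
        tendsto_const[of \<iota>]]
    by (simp add: inner D)
  moreover have "\<forall>\<^sub>F f in F. f o\<^sub>L \<iota> \<in> dual_space"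
    using F(2) by eventually_elim (rule dual_space_compose[OF \<iota>])
  ultimately show "approximately_inner mulA D"
    unfolding approximately_inner_def using F(1)
    by (intro exI[of _ "filtermap (\<lambda>f. f o\<^sub>L \<iota>) F"])
      (simp add: filtermap_bot_iff eventually_filtermap filterlim_filtermap)
qed

text \<open>Linearity carries the zeros from products to their span, continuity from there to the
  closure.\<close>

lemma (in complex_banach_algebra) eq_zero_if_square_dense:
  fixes f :: "'a \<Rightarrow> complex"
  assumes dense: "closure (algebra_square mul) = UNIV" and cont: "continuous_on UNIV f"
    and lin: "Vector_Spaces.linear scaleC scaleC f" and zero: "\<And>a c. f (mul a c) = 0"
  shows "f x = 0"
proof -
  have "f y = 0" if "y \<in> algebra_square mul" for y
    using that unfolding algebra_square_def
  proof (induction rule: complex_vector.span_induct)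
    case base
    have "f 0 = 0" using lin scaleC_of_real[of 0 "0 :: 'a"]
      by (metis complex_linear_iff mult_zero_left of_real_0 scaleC_complex_def scaleR_zero_left)
    then show ?case
      using lin by (simp add: complex_linear_iff complex_vector.subspace_def scaleC_complex_def)
  next
    case (step y)
    then show ?case using zero by blast
  qed
  moreover have "x \<in> closure (algebra_square mul)" by (simp add: dense)
  moreover have "continuous_on (closure (algebra_square mul)) f" using cont dense by simp
  ultimately show ?thesis
    using continuous_constant_on_closure[of "algebra_square mul" f 0 x] by blast
qed

section \<open>Direct sums and their cross terms\<close>

lemma subspace_algebra_square: "complex_vector.subspace (algebra_square mul)"
  unfolding algebra_square_def by (rule complex_vector.subspace_span)

lemma mul_in_algebra_square: "mul a c \<in> algebra_square mul"
  unfolding algebra_square_def by (rule complex_vector.span_base) blast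

text \<open>The direct sum is described by projections and embeddings instead of a fixed
  construction, so that the T-Lau product itself can serve as \<open>mulP\<close>.\<close>

locale banach_algebra_direct_sum =
  P: complex_banach_algebra mulP + A: complex_banach_algebra mulA + B: complex_banach_algebra mulB
  for mulP :: "'p::complex_banach \<Rightarrow> 'p \<Rightarrow> 'p"
    and mulA :: "'a::complex_banach \<Rightarrow> 'a \<Rightarrow> 'a"
    and mulB :: "'b::complex_banach \<Rightarrow> 'b \<Rightarrow> 'b" +
  fixes \<pi> :: "'p \<Rightarrow>\<^sub>L 'a" and \<rho> :: "'p \<Rightarrow>\<^sub>L 'b" and \<iota> :: "'a \<Rightarrow>\<^sub>L 'p" and \<kappa> :: "'b \<Rightarrow>\<^sub>L 'p"
  assumes hom_\<pi>: "banach_hom mulP mulA \<pi>" and hom_\<rho>: "banach_hom mulP mulB \<rho>"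
    and hom_\<iota>: "banach_hom mulA mulP \<iota>" and hom_\<kappa>: "banach_hom mulB mulP \<kappa>"
    and \<pi>_\<iota>: "blinfun_apply \<pi> (blinfun_apply \<iota> a) = a" and \<rho>_\<kappa>: "blinfun_apply \<rho> (blinfun_apply \<kappa> b) = b"
    and decomp: "blinfun_apply \<iota> (blinfun_apply \<pi> x) + blinfun_apply \<kappa> (blinfun_apply \<rho> x) = x"
    and \<iota>_mul_\<kappa>: "mulP (blinfun_apply \<iota> a) (blinfun_apply \<kappa> b) = 0"
    and \<kappa>_mul_\<iota>: "mulP (blinfun_apply \<kappa> b) (blinfun_apply \<iota> a) = 0"
begin

text \<open>Decomposing \<open>\<iota>\<close> of a leaves a zero component under
  \<open>\<kappa>\<close>, and \<open>\<kappa>\<close> is injective because \<open>\<rho>\<close>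
  inverts it.\<close>

lemma \<rho>_\<iota>: "blinfun_apply \<rho> (blinfun_apply \<iota> a) = 0"
proof -
  have "blinfun_apply \<kappa> (blinfun_apply \<rho> (blinfun_apply \<iota> a)) = 0"
    using decomp[of "blinfun_apply \<iota> a"] by (simp add: \<pi>_\<iota>)
  then show ?thesis using \<rho>_\<kappa>[of "blinfun_apply \<rho> (blinfun_apply \<iota> a)"] by (simp add: blinfun.zero_right)
qed

lemma \<pi>_\<kappa>: "blinfun_apply \<pi> (blinfun_apply \<kappa> b) = 0"
proof -
  have "blinfun_apply \<iota> (blinfun_apply \<pi> (blinfun_apply \<kappa> b)) = 0"
    using decomp[of "blinfun_apply \<kappa> b"] by (simp add: \<rho>_\<kappa>)
  then show ?thesis using \<pi>_\<iota>[of "blinfun_apply \<pi> (blinfun_apply \<kappa> b)"] by (simp add: blinfun.zero_right)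
qed

text \<open>If \<open>\<phi>\<close> and \<open>\<psi>\<close> annihilate the squares of the summands, then
  \<open>D x y = \<phi> (\<pi> x) \<psi> (\<rho> y) - \<psi> (\<rho> x) \<phi> (\<pi> y)\<close> is a cyclic derivation, whereas
  the values of inner derivations vanish on pairs from different summands.\<close>

lemma square_dense_if_approx_cyclic_amenable:
  assumes aca: "approx_cyclic_amenable mulP"
  shows "closure (algebra_square mulA) = UNIV \<or> closure (algebra_square mulB) = UNIV"
proof (rule ccontr)
  assume nd: "\<not> ?thesis"
  obtain \<phi> a where \<phi>: "\<phi> \<in> dual_space" "blinfun_apply \<phi> a \<noteq> 0"
    "\<And>m. m \<in> algebra_square mulA \<Longrightarrow> blinfun_apply \<phi> m = 0"
    using exists_dual_annihilator[OF subspace_algebra_square, of mulA] nd by blast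
  obtain \<psi> b where \<psi>: "\<psi> \<in> dual_space" "blinfun_apply \<psi> b \<noteq> 0"
    "\<And>m. m \<in> algebra_square mulB \<Longrightarrow> blinfun_apply \<psi> m = 0"
    using exists_dual_annihilator[OF subspace_algebra_square, of mulB] nd by blast
  define \<phi>' where "\<phi>' = \<phi> o\<^sub>L \<pi>"
  define \<psi>' where "\<psi>' = \<psi> o\<^sub>L \<rho>"
  have scale: "blinfun_apply \<phi>' (c *\<^sub>C x) = c * blinfun_apply \<phi>' x"
    "blinfun_apply \<psi>' (c *\<^sub>C x) = c * blinfun_apply \<psi>' x" for c x
    using dual_space_compose[OF hom_\<pi> \<phi>(1)] dual_space_compose[OF hom_\<rho> \<psi>(1)]
    by (simp_all only: dual_space_iff \<phi>'_def \<psi>'_def)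
  \<comment> \<open>The projections are multiplicative and the functionals annihilate the squares,
    so every term of the product rule for \<open>D\<close> is zero.\<close>
  have mul: "blinfun_apply \<phi>' (mulP x y) = 0" "blinfun_apply \<psi>' (mulP x y) = 0" for x y
    using \<phi>(3)[OF mul_in_algebra_square] \<psi>(3)[OF mul_in_algebra_square] hom_\<pi> hom_\<rho>
    by (simp_all add: \<phi>'_def \<psi>'_def banach_hom_iff)
  define D where "D x = blinfun_apply \<phi>' x *\<^sub>C \<psi>' - blinfun_apply \<psi>' x *\<^sub>C \<phi>'" for x
  have D_apply: "blinfun_apply (D x) y =
      blinfun_apply \<phi>' x * blinfun_apply \<psi>' y - blinfun_apply \<psi>' x * blinfun_apply \<phi>' y" for x y
    by (simp add: D_def blinfun.diff_left scaleC_blinfun_apply scaleC_complex_def)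
  have "derivation mulP D"
    by (simp add: P.derivation_apply D_apply mul scale blinfun.add_right algebra_simps)
  moreover have "cyclic D"
    by (simp add: cyclic_def D_apply)
  moreover have "continuous_on UNIV D"
  proof -
    have c: "continuous_on UNIV (\<lambda>x. blinfun_apply f x *\<^sub>C g)" for f g :: "'p \<Rightarrow>\<^sub>L complex"
    proof (rule linear_continuous_on, rule bounded_linear_intro[where K = "norm f * norm g"])
      show "blinfun_apply f (x + y) *\<^sub>C g = blinfun_apply f x *\<^sub>C g + blinfun_apply f y *\<^sub>C g" for x y
        by (simp add: blinfun.add_right scaleC_add_left)
      show "blinfun_apply f (r *\<^sub>R x) *\<^sub>C g = r *\<^sub>R (blinfun_apply f x *\<^sub>C g)" for r x
        by (simp only: blinfun.scaleR_right scaleR_conv_of_real[where 'a = complex] scaleC_of_real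
            flip: scaleC_scaleC)
      show "norm (blinfun_apply f x *\<^sub>C g) \<le> norm x * (norm f * norm g)" for x
        using mult_right_mono[OF norm_blinfun[of f x] norm_ge_zero[of g]]
        by (simp add: norm_scaleC algebra_simps)
    qed
    show ?thesis unfolding D_def[abs_def] by (intro continuous_on_diff c)
  qed
  ultimately have "approximately_inner mulP D" using aca unfolding approx_cyclic_amenable_def by blast
  then obtain F where F: "F \<noteq> bot" "\<And>x. ((\<lambda>f. inner_derivation mulP f x) \<longlongrightarrow> D x) F"
    unfolding approximately_inner_def by blast
  have "((\<lambda>f. blinfun_apply (inner_derivation mulP f (blinfun_apply \<iota> a)) (blinfun_apply \<kappa> b))
      \<longlongrightarrow> blinfun_apply (D (blinfun_apply \<iota> a)) (blinfun_apply \<kappa> b)) F"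
    by (intro tendsto_intros F(2))
  then have "blinfun_apply (D (blinfun_apply \<iota> a)) (blinfun_apply \<kappa> b) = 0"
    using tendsto_unique[OF F(1) _ tendsto_const]
    by (simp add: P.inner_derivation_apply \<iota>_mul_\<kappa> \<kappa>_mul_\<iota> blinfun.zero_right)
  \<comment> \<open>The value is \<open>\<phi>\<close> at a times \<open>\<psi>\<close> at b; the
    other product is zero because each projection kills the opposite summand.\<close>
  with \<phi>(2) \<psi>(2) show False
    by (simp add: D_apply \<phi>'_def \<psi>'_def \<pi>_\<iota> \<rho>_\<kappa> \<pi>_\<kappa> \<rho>_\<iota> blinfun.zero_right)
qed

text \<open>Expanding \<open>D\<close> at a product from one summand, paired with an element of the
  other, leaves only mixed products as arguments, and these are zero. So the pairing vanishes on
  products, and density of that square extends this to the whole summand.\<close>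

lemma cross_terms_zero:
  assumes D: "continuous_on UNIV D" "derivation mulP D" "cyclic D"
    and dense: "closure (algebra_square mulA) = UNIV \<or> closure (algebra_square mulB) = UNIV"
  shows "blinfun_apply (D (blinfun_apply \<iota> a)) (blinfun_apply \<kappa> b) = 0"
    and "blinfun_apply (D (blinfun_apply \<kappa> b)) (blinfun_apply \<iota> a) = 0"
proof -
  note der = D(2)[unfolded P.derivation_apply]
  have cyc: "blinfun_apply (D x) y = - blinfun_apply (D y) x" for x y
    using D(3) unfolding cyclic_def by (metis add_eq_0_iff2)
  have cont: "continuous_on UNIV (\<lambda>a. blinfun_apply (D (blinfun_apply h a)) y)"
    for h :: "'c::real_normed_vector \<Rightarrow>\<^sub>L 'p" and y
    by (intro continuous_intros continuous_on_compose2[OF D(1)]) auto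
  show 1: "blinfun_apply (D (blinfun_apply \<iota> a)) (blinfun_apply \<kappa> b) = 0"
    using dense
  proof
    assume A2: "closure (algebra_square mulA) = UNIV"
    show ?thesis
    proof (rule A.eq_zero_if_square_dense[OF A2 cont])
      show "Vector_Spaces.linear scaleC scaleC (\<lambda>a. blinfun_apply (D (blinfun_apply \<iota> a)) (blinfun_apply \<kappa> b))"
        using der hom_\<iota>
        by (simp add: complex_linear_iff scaleC_complex_def blinfun.add_right banach_hom_iff)
      show "blinfun_apply (D (blinfun_apply \<iota> (mulA a c))) (blinfun_apply \<kappa> b) = 0" for a c
        using der hom_\<iota> by (simp add: banach_hom_iff \<iota>_mul_\<kappa> \<kappa>_mul_\<iota> blinfun.zero_right)
    qed
  next
    assume B2: "closure (algebra_square mulB) = UNIV"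
    \<comment> \<open>Density of the second square controls the pairing with the derivation taken at
      elements of that summand; cyclicity then swaps the arguments.\<close>
    have "blinfun_apply (D (blinfun_apply \<kappa> b)) (blinfun_apply \<iota> a) = 0"
    proof (rule B.eq_zero_if_square_dense[OF B2 cont])
      show "Vector_Spaces.linear scaleC scaleC (\<lambda>b. blinfun_apply (D (blinfun_apply \<kappa> b)) (blinfun_apply \<iota> a))"
        using der hom_\<kappa>
        by (simp add: complex_linear_iff scaleC_complex_def blinfun.add_right banach_hom_iff)
      show "blinfun_apply (D (blinfun_apply \<kappa> (mulB b c))) (blinfun_apply \<iota> a) = 0" for b c
        using der hom_\<kappa> by (simp add: banach_hom_iff \<iota>_mul_\<kappa> \<kappa>_mul_\<iota> blinfun.zero_right)
    qed
    then show ?thesis by (subst cyc) simp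
  qed
  then show "blinfun_apply (D (blinfun_apply \<kappa> b)) (blinfun_apply \<iota> a) = 0"
    by (subst cyc) simp
qed

text \<open>Without cross terms \<open>D\<close> is the sum of its two restrictions. The nets
  approximating these are independent of each other, so the product filter combines them, with each
  pair of functionals glued along the projections.\<close>

lemma approx_cyclic_amenable_direct_sum:
  assumes aca: "approx_cyclic_amenable mulA" "approx_cyclic_amenable mulB"
    and dense: "closure (algebra_square mulA) = UNIV \<or> closure (algebra_square mulB) = UNIV"
  shows "approx_cyclic_amenable mulP"
  unfolding approx_cyclic_amenable_def
proof (intro allI impI, elim conjE)
  fix D assume D: "continuous_on UNIV D" "derivation mulP D" "cyclic D"
  note der = D(2)[unfolded P.derivation_apply]
  have "approximately_inner mulA (pullback \<iota> D)" "approximately_inner mulB (pullback \<kappa> D)"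
    using aca pullback_cyclic_derivation[OF A.complex_banach_algebra_axioms P.complex_banach_algebra_axioms hom_\<iota> D]
      pullback_cyclic_derivation[OF B.complex_banach_algebra_axioms P.complex_banach_algebra_axioms hom_\<kappa> D]
    unfolding approx_cyclic_amenable_def by blast+
  then obtain F G where F: "F \<noteq> bot" "\<forall>\<^sub>F f in F. f \<in> dual_space"
    "\<And>a. ((\<lambda>f. inner_derivation mulA f a) \<longlongrightarrow> pullback \<iota> D a) F"
    and G: "G \<noteq> bot" "\<forall>\<^sub>F g in G. g \<in> dual_space"
    "\<And>b. ((\<lambda>g. inner_derivation mulB g b) \<longlongrightarrow> pullback \<kappa> D b) G"
    unfolding approximately_inner_def by blast
  define s :: "_ \<Rightarrow> 'p \<Rightarrow>\<^sub>L complex" where "s = (\<lambda>(f, g). (f o\<^sub>L \<pi>) + (g o\<^sub>L \<rho>))"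
  have D_split: "D x = (pullback \<iota> D (blinfun_apply \<pi> x) o\<^sub>L \<pi>) + (pullback \<kappa> D (blinfun_apply \<rho> x) o\<^sub>L \<rho>)" for x
  proof (rule blinfun_eqI)
    fix y
    let ?a = "blinfun_apply \<iota> (blinfun_apply \<pi> x)" and ?b = "blinfun_apply \<kappa> (blinfun_apply \<rho> x)"
    let ?a' = "blinfun_apply \<iota> (blinfun_apply \<pi> y)" and ?b' = "blinfun_apply \<kappa> (blinfun_apply \<rho> y)"
    \<comment> \<open>Of the four terms of the expansion, \<open>cross_terms_zero\<close> removes
      the two mixed ones.\<close>
    have "blinfun_apply (D (?a + ?b)) (?a' + ?b') = blinfun_apply (D ?a) ?a' + blinfun_apply (D ?b) ?b'"
      using der by (simp add: blinfun.add_right cross_terms_zero[OF D dense])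
    then show "blinfun_apply (D x) y = blinfun_apply
        ((pullback \<iota> D (blinfun_apply \<pi> x) o\<^sub>L \<pi>) + (pullback \<kappa> D (blinfun_apply \<rho> x) o\<^sub>L \<rho>)) y"
      by (simp add: decomp blinfun.add_left)
  qed
  \<comment> \<open>Multiplicativity of the projections makes inner derivations of glued functionals
    split in the same way.\<close>
  have inner: "inner_derivation mulP (s fg) x =
      (inner_derivation mulA (fst fg) (blinfun_apply \<pi> x) o\<^sub>L \<pi>) +
      (inner_derivation mulB (snd fg) (blinfun_apply \<rho> x) o\<^sub>L \<rho>)" for fg x
    using hom_\<pi> hom_\<rho>
    by (intro blinfun_eqI) (simp add: s_def P.inner_derivation_apply A.inner_derivation_apply
        B.inner_derivation_apply blinfun.add_left banach_hom_iff split: prod.split)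
  have "((\<lambda>fg. inner_derivation mulP (s fg) x) \<longlongrightarrow> D x) (F \<times>\<^sub>F G)" for x
    unfolding inner D_split[of x]
    by (intro tendsto_add bounded_bilinear.tendsto[OF bounded_bilinear_blinfun_compose] tendsto_const
        filterlim_compose[OF F(3) filterlim_fst] filterlim_compose[OF G(3) filterlim_snd])
  moreover have "\<forall>\<^sub>F fg in F \<times>\<^sub>F G. s fg \<in> dual_space"
    using eventually_prodI[OF F(2) G(2)]
  proof eventually_elim
    case (elim fg)
    then show ?case
      using hom_\<pi> hom_\<rho>
      by (auto simp: s_def dual_space_iff banach_hom_iff blinfun.add_left algebra_simps split: prod.split)
  qed
  moreover have "F \<times>\<^sub>F G \<noteq> bot" using F(1) G(1) by (simp add: prod_filter_eq_bot)
  ultimately show "approximately_inner mulP D"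
    unfolding approximately_inner_def
    by (intro exI[of _ "filtermap s (F \<times>\<^sub>F G)"])
      (simp add: filtermap_bot_iff eventually_filtermap filterlim_filtermap)
qed

theorem approx_cyclic_amenable_iff:
  "approx_cyclic_amenable mulP \<longleftrightarrow>
    (approx_cyclic_amenable mulA \<and> approx_cyclic_amenable mulB) \<and>
    (closure (algebra_square mulA) = UNIV \<or> closure (algebra_square mulB) = UNIV)"
  using approx_cyclic_amenable_direct_sum square_dense_if_approx_cyclic_amenable
    approx_cyclic_amenable_retract[OF P.complex_banach_algebra_axioms A.complex_banach_algebra_axioms hom_\<pi> hom_\<iota> \<pi>_\<iota>]
    approx_cyclic_amenable_retract[OF P.complex_banach_algebra_axioms B.complex_banach_algebra_axioms hom_\<rho> hom_\<kappa> \<rho>_\<kappa>]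
  by blast

end

section \<open>The T-Lau product as a direct sum\<close>

theorem theorem3p2:
  fixes mulA :: "'a::complex_banach \<Rightarrow> 'a \<Rightarrow> 'a"
    and mulB :: "'b::complex_banach \<Rightarrow> 'b \<Rightarrow> 'b"
    and T :: "'b \<Rightarrow> 'a"
  assumes "complex_banach_algebra mulA"
    and "complex_banach_algebra mulB"
    and "algebra_homomorphism mulB mulA T"
    and "bounded_linear T"
    and "onorm T \<le> 1"
  shows "approx_cyclic_amenable (lau_mul mulA mulB T) \<longleftrightarrow>
    (approx_cyclic_amenable mulA \<and> approx_cyclic_amenable mulB) \<and>
    (closure (algebra_square mulA) = UNIV \<or> closure (algebra_square mulB) = UNIV)"
proof -
  interpret A: complex_banach_algebra mulA by fact
  interpret B: complex_banach_algebra mulB by fact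
  interpret P: complex_banach_algebra "lau_mul mulA mulB T"
    by (rule complex_banach_algebra_lau_mul[OF assms])
  interpret T: bounded_linear T by fact
  have T_mul: "T (mulB x y) = mulA (T x) (T y)" and T_scaleC: "T (c *\<^sub>C x) = c *\<^sub>C T x" for c x y
    using assms(3) by (simp_all add: algebra_homomorphism_def complex_linear_iff)
  have nT: "norm (T x) \<le> norm x" for x
    using onorm[OF assms(4), of x] mult_right_mono[OF assms(5) norm_ge_zero[of x]] by simp
  \<comment> \<open>The twisted terms of the product are exactly those completing (a + T b)(a' + T
    b'), which makes this map multiplicative.\<close>
  define \<pi> where "\<pi> x = l1_fst x + T (l1_snd x)" for x
  \<comment> \<open>The component \<open>- T b\<close> makes products with (a, 0) cancel, as in a (-
    T b) + a (T b) = 0, and puts the copy of the second algebra into the kernel of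
    \<open>\<pi>\<close>.\<close>
  define \<kappa> where "\<kappa> b = L1 (- T b) b" for b
  have "bounded_linear \<pi>"
    by (rule bounded_linear_intro[where K = 1])
      (auto simp: \<pi>_def T.add T.scaleR algebra_simps norm_l1_prod_def intro: norm_triangle_mono nT)
  note \<pi> = bounded_linear_Blinfun_apply[OF this]
  have "bounded_linear (l1_snd :: ('a, 'b) l1_prod \<Rightarrow> 'b)"
    by (rule bounded_linear_intro[where K = 1]) (auto simp: norm_l1_prod_def)
  note \<rho> = bounded_linear_Blinfun_apply[OF this]
  have "bounded_linear (\<lambda>a :: 'a. L1 a (0 :: 'b))"
    by (rule bounded_linear_intro[where K = 1]) (auto simp: norm_l1_prod_def l1_prod_eq_iff)
  note \<iota> = bounded_linear_Blinfun_apply[OF this]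
  \<comment> \<open>The constant 2 bounds the norm of \<open>T b\<close> plus that of
    \<open>b\<close>, as \<open>T\<close> is a contraction.\<close>
  have "bounded_linear \<kappa>"
  proof (rule bounded_linear_intro[where K = 2])
    show "norm (\<kappa> b) \<le> norm b * 2" for b using nT[of b] by (simp add: \<kappa>_def norm_l1_prod_def)
  qed (auto simp: \<kappa>_def T.add T.scaleR l1_prod_eq_iff)
  note \<kappa> = bounded_linear_Blinfun_apply[OF this]
  have neg: "mulA (- x) y = - mulA x y" "mulA x (- y) = - mulA x y" for x y
    by (simp_all add: bounded_bilinear.minus_left[OF A.bounded_bilinear_mul]
        bounded_bilinear.minus_right[OF A.bounded_bilinear_mul])
  note zero = bounded_bilinear.zero_left[OF A.bounded_bilinear_mul]
    bounded_bilinear.zero_right[OF A.bounded_bilinear_mul]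
    bounded_bilinear.zero_left[OF B.bounded_bilinear_mul]
    bounded_bilinear.zero_right[OF B.bounded_bilinear_mul]
  \<comment> \<open>That \<open>\<kappa>\<close> is multiplicative comes down to (T b)(T b') - (T
    b)(T b') - (T b)(T b') = - T (b b').\<close>
  interpret banach_algebra_direct_sum "lau_mul mulA mulB T" mulA mulB
    "Blinfun \<pi>" "Blinfun l1_snd" "Blinfun (\<lambda>a. L1 a 0)" "Blinfun \<kappa>"
    by unfold_locales
      (simp_all add: banach_hom_iff \<pi> \<rho> \<iota> \<kappa> \<pi>_def \<kappa>_def lau_mul_def scaleC_l1_prod_def l1_prod_eq_iff
        T.add T.zero T_mul T_scaleC neg zero A.mul_add_left A.mul_add_right scaleC_add_right)
  show ?thesis by (rule approx_cyclic_amenable_iff)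
qed

end
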